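(* As the integer $d$ tends to $+\infty$, $$\int_{\mathbb{R}^2}\min\left(1,\frac{d\,a(t)}{4\pi}\right)dt=\frac32\ln(d)^2+3\left(1+\ln(\pi)\right)\ln(d)+O(1).$$
   Context: For $t=(t_1,t_2)\in\mathbb{R}^2$, $a(t)$ is the Fubini-Study area of the torus $\{[1:z_1:z_2]\in\mathbb{CP}^2:\ |z_1|=e^{t_1},|z_2|=e^{t_2}\}$, namely $a(t)=\dfrac{4\pi^2e^{t_1}e^{t_2}}{(1+e^{2t_1}+e^{2t_2})^{3/2}}$. *)

theory Defs
  imports "HOL-Analysis.Analysis" "HOL-Library.Landau_Symbols"
begin

text \<open>
  The Fubini-Study area of the torus of all points [1 : z1 : z2] of the complex projective plane
  with |z1| = exp t1 and |z2| = exp t2, given by its closed form. The metric is normalised so that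
  a projective line has area pi.
\<close>

definition torus_area :: "real \<times> real \<Rightarrow> real" where
  "torus_area = (\<lambda>(t1, t2).
     4 * pi\<^sup>2 * exp t1 * exp t2 / (1 + exp (2 * t1) + exp (2 * t2)) powr (3 / 2))"

end

theory Submission
  imports Defs "HOL-Real_Asymp.Real_Asymp"
begin

text \<open>
  With \<open>L = ln (pi * d)\<close> the integrand is the minimum of 1 and \<open>exp (L - \<phi> t)\<close>, where
  \<open>\<phi> t = 3 / 2 * ln (1 + exp (2 * t1) + exp (2 * t2)) - t1 - t2\<close>. The symmetry that permutes
  the homogeneous coordinates of the plane cuts it into three congruent sectors, according to which
  of 0, t1, t2 is the largest; on each of them \<open>\<phi>\<close> becomes \<open>x + y\<close> plus an error of order
  \<open>exp (- 2 * x) + exp (- 2 * y)\<close>, in coordinates \<open>x, y \<ge> 0\<close> given by a unimodular map.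
  Without the error, a sector contributes exactly \<open>L\<^sup>2 / 2 + L + 1\<close>. The error only matters
  near the line \<open>x + y = L\<close>, so its total contribution is bounded.
\<close>

section \<open>Exponential integrals on the line and the model integral over the quadrant\<close>

lemma nn_integral_exp_neg_atLeast:
  fixes a b u :: real
  assumes "0 < a"
  shows "(\<integral>\<^sup>+x. ennreal (exp (u - a * x)) * indicator {b..} x \<partial>lborel) = ennreal (exp (u - a * b) / a)"
proof -
  have lim: "((\<lambda>x. - exp (u - a * x) / a) \<longlongrightarrow> 0) at_top"
    using assms by real_asymp
  have "(\<integral>\<^sup>+x. ennreal (exp (u - a * x)) * indicator {b..} x \<partial>lborel) = ennreal (0 - (- exp (u - a * b) / a))"
    using assms by (intro nn_integral_FTC_atLeast lim) (auto intro!: derivative_eq_intros)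
  then show ?thesis by simp
qed

text \<open>Translation invariance removes \<open>u\<close>; this independence later makes the error
  bound uniform in \<open>L\<close>.\<close>

lemma nn_integral_exp_neg_abs: "(\<integral>\<^sup>+x. ennreal (exp (- \<bar>u - x\<bar>)) \<partial>lborel) = 2"
proof -
  have "(\<integral>\<^sup>+x. ennreal (exp (- \<bar>u - x\<bar>)) \<partial>lborel) = (\<integral>\<^sup>+x. ennreal (exp (- \<bar>x\<bar>)) \<partial>lborel)"
    by (subst nn_integral_real_affine[where c=1 and t=u]) auto
  also have "\<dots> = (\<integral>\<^sup>+x. ennreal (exp (- x)) * indicator {0..} x + ennreal (exp x) * indicator {..<0} x \<partial>lborel)"
    by (intro nn_integral_cong) (auto simp: indicator_def)
  also have "\<dots> = (\<integral>\<^sup>+x. ennreal (exp (- x)) * indicator {0..} x \<partial>lborel)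
      + (\<integral>\<^sup>+x. ennreal (exp x) * indicator {..<0} x \<partial>lborel)"
    by (intro nn_integral_add) auto
  also have "(\<integral>\<^sup>+x. ennreal (exp x) * indicator {..<0} x \<partial>lborel)
      = (\<integral>\<^sup>+x. ennreal (exp (- x)) * indicator {..<0} (- x) \<partial>lborel)"
    by (subst nn_integral_real_affine[where c="-1" and t=0]) auto
  also have "\<dots> = (\<integral>\<^sup>+x. ennreal (exp (- x)) * indicator {0..} x \<partial>lborel)"
    using AE_lborel_singleton[of 0]
    by (intro nn_integral_cong_AE, eventually_elim) (auto simp: indicator_def)
  also have "(\<integral>\<^sup>+x. ennreal (exp (- x)) * indicator {0..} x \<partial>lborel) = 1"
    using nn_integral_exp_neg_atLeast[of 1 0 0] by simp
  finally show ?thesis by simp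
qed

lemma nn_integral_min_one_exp:
  "(\<integral>\<^sup>+y. ennreal (min 1 (exp (u - y))) * indicator {0..} y \<partial>lborel)
     = ennreal (if 0 \<le> u then u + 1 else exp u)"
proof (cases "0 \<le> u")
  case True
  have "(\<integral>\<^sup>+y. ennreal (min 1 (exp (u - y))) * indicator {0..} y \<partial>lborel)
     = (\<integral>\<^sup>+y. indicator {0..<u} y + ennreal (exp (u - y)) * indicator {u..} y \<partial>lborel)"
    using True by (intro nn_integral_cong) (auto simp: indicator_def min_def)
  also have "\<dots> = (\<integral>\<^sup>+y. indicator {0..<u} y \<partial>lborel) + (\<integral>\<^sup>+y. ennreal (exp (u - y)) * indicator {u..} y \<partial>lborel)"
    by (intro nn_integral_add) auto
  also have "\<dots> = ennreal u + 1"
    using True nn_integral_exp_neg_atLeast[of 1 u u] by simp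
  finally show ?thesis using True by simp
next
  case False
  have "(\<integral>\<^sup>+y. ennreal (min 1 (exp (u - y))) * indicator {0..} y \<partial>lborel)
     = (\<integral>\<^sup>+y. ennreal (exp (u - y)) * indicator {0..} y \<partial>lborel)"
    using False by (intro nn_integral_cong) (auto simp: indicator_def min_def)
  then show ?thesis using False nn_integral_exp_neg_atLeast[of 1 u 0] by simp
qed

lemma nn_integral_min_one_exp_quadrant:
  assumes "0 \<le> L"
  shows "(\<integral>\<^sup>+x. \<integral>\<^sup>+y. ennreal (min 1 (exp (L - x - y))) * indicator {0..} x * indicator {0..} y \<partial>lborel \<partial>lborel)
     = ennreal (L\<^sup>2 / 2 + L + 1)"
proof -
  have "(\<integral>\<^sup>+x. \<integral>\<^sup>+y. ennreal (min 1 (exp (L - x - y))) * indicator {0..} x * indicator {0..} y \<partial>lborel \<partial>lborel)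
     = (\<integral>\<^sup>+x. (\<integral>\<^sup>+y. ennreal (min 1 (exp (L - x - y))) * indicator {0..} y \<partial>lborel) * indicator {0..} x \<partial>lborel)"
    by (intro nn_integral_cong) (auto simp: indicator_def)
  also have "\<dots> = (\<integral>\<^sup>+x. ennreal (L - x + 1) * indicator {0..L} x + ennreal (exp (L - x)) * indicator {L..} x \<partial>lborel)"
    unfolding nn_integral_min_one_exp
    \<comment> \<open>The two intervals share the point \<open>x = L\<close>, where the sum is 2
      instead of 1, so the integrands agree only almost everywhere.\<close>
    using AE_lborel_singleton[of L]
    by (intro nn_integral_cong_AE, eventually_elim) (use assms in \<open>auto simp: indicator_def\<close>)
  also have "\<dots> = (\<integral>\<^sup>+x. ennreal (L - x + 1) * indicator {0..L} x \<partial>lborel)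
      + (\<integral>\<^sup>+x. ennreal (exp (L - x)) * indicator {L..} x \<partial>lborel)"
    by (intro nn_integral_add) auto
  also have "(\<integral>\<^sup>+x. ennreal (L - x + 1) * indicator {0..L} x \<partial>lborel)
      = ennreal ((L * L - L\<^sup>2 / 2 + L) - (L * 0 - 0\<^sup>2 / 2 + 0))"
    using assms by (intro nn_integral_FTC_Icc) (auto intro!: derivative_eq_intros)
  also have "(\<integral>\<^sup>+x. ennreal (exp (L - x)) * indicator {L..} x \<partial>lborel) = 1"
    using nn_integral_exp_neg_atLeast[of 1 L L] by simp
  also have "ennreal ((L * L - L\<^sup>2 / 2 + L) - (L * 0 - 0\<^sup>2 / 2 + 0)) + 1 = ennreal (L\<^sup>2 / 2 + L + 1)"
    using assms by (simp add: power2_eq_square flip: ennreal_1 ennreal_plus)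
  finally show ?thesis .
qed

section \<open>The sector integrand against the model \<open>min 1 (exp (L - x - y))\<close>\<close>

definition sector_density :: "real \<Rightarrow> real \<Rightarrow> real \<Rightarrow> real" where
  "sector_density L x y =
     min 1 (exp (L - x - y) / (1 + exp (- (2 * x)) + exp (- (2 * y))) powr (3 / 2))"

lemma sector_density_nonneg: "0 \<le> sector_density L x y"
  by (simp add: sector_density_def)

lemma measurable_sector_density [measurable]:
  assumes [measurable]: "f \<in> borel_measurable M" "g \<in> borel_measurable M"
  shows "(\<lambda>z. sector_density L (f z) (g z)) \<in> borel_measurable M"
  unfolding sector_density_def by measurable

lemma sector_density_le: "sector_density L x y \<le> min 1 (exp (L - x - y))"
proof -
  have "1 \<le> (1 + exp (- (2 * x)) + exp (- (2 * y))) powr (3 / 2)"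
    by (rule ge_one_powr_ge_zero) (auto intro: add_increasing2)
  then have "exp (L - x - y) / (1 + exp (- (2 * x)) + exp (- (2 * y))) powr (3 / 2) \<le> exp (L - x - y) / 1"
    by (intro divide_left_mono) auto
  then show ?thesis
    by (auto simp: sector_density_def)
qed

text \<open>Two tangent-line inequalities, for \<open>exp\<close> and for \<open>ln\<close>, make
  the relative loss caused by the denominator linear in \<open>q\<close>, hence exponentially small
  away from the axes.\<close>

lemma one_minus_inverse_powr_le:
  fixes q p :: real
  assumes "0 \<le> q" "0 \<le> p"
  shows "1 - 1 / (1 + q) powr p \<le> p * q"
proof -
  have "1 + (- p * ln (1 + q)) \<le> exp (- p * ln (1 + q))"
    by (rule exp_ge_add_one_self)
  also have "\<dots> = 1 / (1 + q) powr p"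
    using assms by (simp add: powr_def exp_minus field_simps)
  finally have "1 - 1 / (1 + q) powr p \<le> p * ln (1 + q)" by simp
  also have "\<dots> \<le> p * q"
    using assms by (intro mult_left_mono ln_add_one_self_le_self) auto
  finally show ?thesis .
qed

text \<open>Above the threshold \<open>W <= a\<close> both minima are 1 and nothing is lost. Below
  it the relative loss is of order \<open>q\<close>, and \<open>a < W <= 6\<close> bounds
  \<open>min 1 a\<close> by a multiple of \<open>exp (- abs (L - x - y))\<close>, which confines the
  error to the line \<open>x + y = L\<close>. The constant 9 is 6 * 3 / 2.\<close>

lemma min_one_exp_le_sector_density:
  assumes "0 \<le> x" "0 \<le> y"
  shows "min 1 (exp (L - x - y)) \<le> sector_density L x y
     + 9 * (exp (- (2 * x)) + exp (- (2 * y))) * exp (- \<bar>L - x - y\<bar>)"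
proof -
  define q where "q = exp (- (2 * x)) + exp (- (2 * y))"
  define W where "W = (1 + q) powr (3 / 2)"
  define a where "a = exp (L - x - y)"
  have "exp (- (2 * x)) \<le> 1" "exp (- (2 * y)) \<le> 1" using assms by auto
  then have q: "0 < q" "q \<le> 2" unfolding q_def by (auto intro: add_pos_pos simp del: exp_le_one_iff)
  have W1: "1 \<le> W" unfolding W_def by (rule ge_one_powr_ge_zero) (use q in auto)
  have "W \<le> 3 powr (3 / 2)" unfolding W_def using q by (intro powr_mono2) auto
  also have "\<dots> \<le> 6"
  proof -
    have "(3 powr (3 / 2))\<^sup>2 = (3::real) powr 3" by (simp add: powr_powr flip: powr_realpow)
    then have "(3 powr (3 / 2))\<^sup>2 \<le> (6::real)\<^sup>2" by simp
    then show ?thesis by (rule power2_le_imp_le) simp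
  qed
  finally have "W \<le> 6" .
  have w: "1 - 1 / W \<le> 3 / 2 * q" unfolding W_def by (rule one_minus_inverse_powr_le) (use q in auto)
  have a: "0 < a" by (simp add: a_def)
  have "min 1 a \<le> min 1 (a / W) + 9 * q * exp (- \<bar>L - x - y\<bar>)"
  proof (cases "W \<le> a")
    case True
    then have "min 1 (a / W) = 1" using W1 by (simp add: field_simps min_def)
    then show ?thesis using q by (simp add: add_increasing2)
  next
    case False
    \<comment> \<open>For \<open>1 <= a < W\<close> the exponential is \<open>1 / a\<close>, at
      least 1/6; for \<open>a < 1\<close> it is \<open>a\<close> itself.\<close>
    have e: "min 1 a \<le> 6 * exp (- \<bar>L - x - y\<bar>)"
    proof (cases "1 \<le> a")
      case True
      then have "\<bar>L - x - y\<bar> = L - x - y" by (simp add: a_def)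
      then have "exp (- \<bar>L - x - y\<bar>) = 1 / a"
        by (simp add: a_def exp_minus inverse_eq_divide del: minus_diff_eq)
      moreover have "1 \<le> 6 * (1 / a)" using False \<open>W \<le> 6\<close> a by simp
      ultimately show ?thesis using True by simp
    next
      case 2: False
      then have "exp (- \<bar>L - x - y\<bar>) = a" by (simp add: a_def)
      then show ?thesis using a by simp
    qed
    \<comment> \<open>For \<open>a <= 1\<close> this is an equality; for \<open>1 <= a < W\<close>
      it says that \<open>1 - a / W\<close> is at most \<open>1 - 1 / W\<close>.\<close>
    have "min 1 a - min 1 (a / W) \<le> min 1 a * (1 - 1 / W)"
      using False W1 a by (auto simp: min_def field_simps)
    also have "\<dots> \<le> (6 * exp (- \<bar>L - x - y\<bar>)) * (3 / 2 * q)"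
      using e w W1 q by (intro mult_mono) (auto simp: field_simps)
    finally show ?thesis by simp
  qed
  then show ?thesis by (simp add: sector_density_def W_def a_def q_def add.assoc)
qed

section \<open>The integrated error and the bounds for one sector\<close>

lemma nn_integral_error_le:
  "(\<integral>\<^sup>+x. \<integral>\<^sup>+y. ennreal (exp (- (2 * x)) * exp (- \<bar>L - x - y\<bar>)) * indicator {0..} x * indicator {0..} y \<partial>lborel \<partial>lborel) \<le> 1"
proof -
  \<comment> \<open>Letting \<open>y\<close> run over the whole line makes the inner integral of
    \<open>exp (- abs (L - x - y))\<close> equal to 2 for every \<open>x\<close> and
    \<open>L\<close>; the decay in \<open>x\<close> contributes the factor 1/2.\<close>
  have "(\<integral>\<^sup>+x. \<integral>\<^sup>+y. ennreal (exp (- (2 * x)) * exp (- \<bar>L - x - y\<bar>)) * indicator {0..} x * indicator {0..} y \<partial>lborel \<partial>lborel)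
      \<le> (\<integral>\<^sup>+x. \<integral>\<^sup>+y. (ennreal (exp (- (2 * x))) * indicator {0..} x) * ennreal (exp (- \<bar>(L - x) - y\<bar>)) \<partial>lborel \<partial>lborel)"
    by (intro nn_integral_mono) (auto simp: indicator_def ennreal_mult)
  also have "\<dots> = (\<integral>\<^sup>+x. (ennreal (exp (- (2 * x))) * indicator {0..} x) * 2 \<partial>lborel)"
    by (simp add: nn_integral_cmult nn_integral_exp_neg_abs)
  also have "\<dots> = (\<integral>\<^sup>+x. ennreal (exp (- (2 * x))) * indicator {0..} x \<partial>lborel) * 2"
    by (intro nn_integral_multc) auto
  also have "\<dots> = ennreal (1 / 2) * 2"
    using nn_integral_exp_neg_atLeast[of 2 0 0] by simp
  also have "\<dots> = ennreal (1 / 2 * 2)" by (subst ennreal_mult) auto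
  finally show ?thesis by simp
qed

text \<open>Iterated and \<open>ennreal\<close>-valued, so that splitting, Tonelli and one-variable
  substitutions apply without integrability conditions.\<close>

definition sector_integral :: "real \<Rightarrow> ennreal" where
  "sector_integral L =
     (\<integral>\<^sup>+x. \<integral>\<^sup>+y. ennreal (sector_density L x y) * indicator {0..} x * indicator {0..} y \<partial>lborel \<partial>lborel)"

lemma sector_integral_le:
  assumes "0 \<le> L"
  shows "sector_integral L \<le> ennreal (L\<^sup>2 / 2 + L + 1)"
  unfolding sector_integral_def nn_integral_min_one_exp_quadrant[OF assms, symmetric]
  by (intro nn_integral_mono mult_right_mono ennreal_leI sector_density_le) auto

text \<open>The two summands of the pointwise error are exchanged by swapping \<open>x\<close> and
  \<open>y\<close>, so Tonelli reduces both to one estimate, and 18 is 9 * (1 + 1). The error is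
  added on the right because subtraction in \<open>ennreal\<close> is truncated.\<close>

lemma le_sector_integral:
  assumes "0 \<le> L"
  shows "ennreal (L\<^sup>2 / 2 + L + 1) \<le> sector_integral L + 18"
proof -
  define I where "I x y = indicator {0..} x * (indicator {0..} y :: ennreal)" for x y :: real
  define e where "e x y = ennreal (exp (- (2 * x)) * exp (- \<bar>L - x - y\<bar>)) * I x y" for x y
  have [measurable]: "(\<lambda>(x, y). I x y) \<in> borel_measurable (lborel \<Otimes>\<^sub>M lborel)"
    unfolding I_def by measurable
  have [measurable]: "(\<lambda>(x, y). e x y) \<in> borel_measurable (lborel \<Otimes>\<^sub>M lborel)"
    unfolding e_def by measurable
  have e1: "(\<integral>\<^sup>+x. \<integral>\<^sup>+y. e x y \<partial>lborel \<partial>lborel) \<le> 1"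
    using nn_integral_error_le[of L] by (simp add: e_def I_def mult.assoc)
  have "(\<integral>\<^sup>+x. \<integral>\<^sup>+y. e y x \<partial>lborel \<partial>lborel) = (\<integral>\<^sup>+x. \<integral>\<^sup>+y. e x y \<partial>lborel \<partial>lborel)"
    by (rule lborel_pair.Fubini') measurable
  with e1 have e2: "(\<integral>\<^sup>+x. \<integral>\<^sup>+y. e y x \<partial>lborel \<partial>lborel) \<le> 1" by simp
  have "ennreal (L\<^sup>2 / 2 + L + 1)
      = (\<integral>\<^sup>+x. \<integral>\<^sup>+y. ennreal (min 1 (exp (L - x - y))) * I x y \<partial>lborel \<partial>lborel)"
    unfolding nn_integral_min_one_exp_quadrant[OF assms, symmetric] by (simp add: I_def mult.assoc)
  also have "\<dots> \<le> (\<integral>\<^sup>+x. \<integral>\<^sup>+y. ennreal (sector_density L x y) * I x y + 9 * (e x y + e y x) \<partial>lborel \<partial>lborel)"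
  proof (intro nn_integral_mono)
    fix x y :: real
    show "ennreal (min 1 (exp (L - x - y))) * I x y
        \<le> ennreal (sector_density L x y) * I x y + 9 * (e x y + e y x)"
    proof (cases "0 \<le> x \<and> 0 \<le> y")
      case True
      have "min 1 (exp (L - x - y)) \<le> sector_density L x y
          + 9 * (exp (- (2 * x)) * exp (- \<bar>L - x - y\<bar>) + exp (- (2 * y)) * exp (- \<bar>L - y - x\<bar>))"
        using min_one_exp_le_sector_density[of x y L] True by (simp add: algebra_simps)
      then show ?thesis
        using True unfolding I_def e_def
        by (simp add: sector_density_nonneg flip: ennreal_plus ennreal_mult' ennreal_numeral)
    qed (auto simp: I_def)
  qed
  also have "\<dots> = sector_integral L
      + 9 * ((\<integral>\<^sup>+x. \<integral>\<^sup>+y. e x y \<partial>lborel \<partial>lborel) + (\<integral>\<^sup>+x. \<integral>\<^sup>+y. e y x \<partial>lborel \<partial>lborel))"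
    by (simp add: nn_integral_add nn_integral_cmult sector_integral_def I_def mult.assoc)
  also have "\<dots> \<le> sector_integral L + 9 * (1 + 1)"
    by (intro add_left_mono mult_left_mono add_mono e1 e2) auto
  finally show ?thesis by simp
qed

section \<open>Cutting the plane into three sectors\<close>

definition truncated_area :: "real \<Rightarrow> real \<Rightarrow> real \<Rightarrow> real" where
  "truncated_area L s t =
     min 1 (exp (L + s + t) / (1 + exp (2 * s) + exp (2 * t)) powr (3 / 2))"

lemma truncated_area_commute: "truncated_area L s t = truncated_area L t s"
  by (simp add: truncated_area_def algebra_simps)

lemma truncated_area_neg: "truncated_area L (- x) (- y) = sector_density L x y"
  by (simp add: truncated_area_def sector_density_def)

text \<open>This amounts to dividing the homogeneous coordinates by \<open>z1\<close>: relative to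
  \<open>s = x\<close>, the logarithms 0 and \<open>t\<close> become \<open>- x\<close> and
  \<open>- y\<close>. The factor \<open>exp (2 * x)\<close> pulled out of the denominator turns into
  \<open>exp (3 * x)\<close> under the power 3/2 and cancels against the numerator.\<close>

lemma truncated_area_shear: "truncated_area L x (x - y) = sector_density L x y"
proof -
  have "1 + exp (2 * x) + exp (2 * (x - y)) = exp (2 * x) * (1 + exp (- (2 * x)) + exp (- (2 * y)))"
    by (simp add: algebra_simps flip: exp_add)
  then have "(1 + exp (2 * x) + exp (2 * (x - y))) powr (3 / 2)
      = exp (3 * x) * (1 + exp (- (2 * x)) + exp (- (2 * y))) powr (3 / 2)"
    by (simp add: powr_mult exp_powr_real)
  moreover have "exp (L + x + (x - y)) = exp (3 * x) * exp (L - x - y)"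
    by (simp add: algebra_simps flip: exp_add)
  ultimately show ?thesis
    unfolding truncated_area_def sector_density_def by (simp only:) simp
qed

lemma measurable_truncated_area [measurable]:
  assumes [measurable]: "f \<in> borel_measurable M" "g \<in> borel_measurable M"
  shows "(\<lambda>z. truncated_area L (f z) (g z)) \<in> borel_measurable M"
  unfolding truncated_area_def by measurable

lemma sector_integral_neg:
  "(\<integral>\<^sup>+s. \<integral>\<^sup>+t. ennreal (truncated_area L s t) * indicator {..0} s * indicator {..0} t \<partial>lborel \<partial>lborel)
     = sector_integral L"
proof -
  have "(\<integral>\<^sup>+s. \<integral>\<^sup>+t. ennreal (truncated_area L s t) * indicator {..0} s * indicator {..0} t \<partial>lborel \<partial>lborel)
      = (\<integral>\<^sup>+x. \<integral>\<^sup>+t. ennreal (truncated_area L (- x) t) * indicator {..0} (- x) * indicator {..0} t \<partial>lborel \<partial>lborel)"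
    by (subst nn_integral_real_affine[where c="-1" and t=0]) auto
  also have "\<dots> = (\<integral>\<^sup>+x. \<integral>\<^sup>+y. ennreal (truncated_area L (- x) (- y)) * indicator {..0} (- x) * indicator {..0} (- y) \<partial>lborel \<partial>lborel)"
    by (rule nn_integral_cong, subst nn_integral_real_affine[where c="-1" and t=0]) auto
  also have "\<dots> = sector_integral L"
    unfolding sector_integral_def truncated_area_neg
    by (intro nn_integral_cong) (auto simp: indicator_def)
  finally show ?thesis .
qed

text \<open>For fixed \<open>s\<close> the map \<open>t = s - y\<close> is affine of slope -1, so no
  planar change of variables is needed. Both forms of \<open>A\<close> are allowed so that the two
  sectors meeting along the diagonal can be taken disjoint; the boundary lines are null.\<close>

lemma sector_integral_shear:
  assumes "A = {..0} \<or> A = {..<0::real}"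
  shows "(\<integral>\<^sup>+s. \<integral>\<^sup>+t. ennreal (truncated_area L s t) * indicator {0<..} s * indicator A (t - s) \<partial>lborel \<partial>lborel)
     = sector_integral L"
proof -
  have [measurable]: "A \<in> sets borel" using assms by auto
  have "(\<integral>\<^sup>+t. ennreal (truncated_area L x t) * indicator {0<..} x * indicator A (t - x) \<partial>lborel)
      = (\<integral>\<^sup>+y. ennreal (sector_density L x y) * indicator {0<..} x * indicator {0..} y \<partial>lborel)" for x
  proof -
    have "(\<integral>\<^sup>+t. ennreal (truncated_area L x t) * indicator {0<..} x * indicator A (t - x) \<partial>lborel)
        = (\<integral>\<^sup>+y. ennreal (truncated_area L x (x - y)) * indicator {0<..} x * indicator A (- y) \<partial>lborel)"
      by (subst nn_integral_real_affine[where c="-1" and t=x]) auto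
    also have "\<dots> = (\<integral>\<^sup>+y. ennreal (sector_density L x y) * indicator {0<..} x * indicator {0..} y \<partial>lborel)"
      unfolding truncated_area_shear
      using AE_lborel_singleton[of "0::real"]
      by (intro nn_integral_cong_AE, eventually_elim) (use assms in \<open>auto simp: indicator_def\<close>)
    finally show ?thesis .
  qed
  then have "(\<integral>\<^sup>+s. \<integral>\<^sup>+t. ennreal (truncated_area L s t) * indicator {0<..} s * indicator A (t - s) \<partial>lborel \<partial>lborel)
      = (\<integral>\<^sup>+x. \<integral>\<^sup>+y. ennreal (sector_density L x y) * indicator {0<..} x * indicator {0..} y \<partial>lborel \<partial>lborel)"
    by simp
  also have "\<dots> = sector_integral L"
    unfolding sector_integral_def
    using AE_lborel_singleton[of "0::real"]
    by (intro nn_integral_cong_AE, eventually_elim) (auto simp: indicator_def)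
  finally show ?thesis .
qed

lemma nn_integral_truncated_area:
  "(\<integral>\<^sup>+p. ennreal (truncated_area L (fst p) (snd p)) \<partial>lborel) = 3 * sector_integral L"
proof -
  let ?f = "\<lambda>s t. ennreal (truncated_area L s t)"
  have "(\<integral>\<^sup>+p. ?f (fst p) (snd p) \<partial>lborel) = (\<integral>\<^sup>+s. \<integral>\<^sup>+t. ?f s t \<partial>lborel \<partial>lborel)"
    unfolding lborel_prod[symmetric]
    using lborel.nn_integral_fst[of "\<lambda>p. ?f (fst p) (snd p)" lborel] by simp
  \<comment> \<open>The largest of 0, \<open>s\<close>, \<open>t\<close> selects the sector. Ties go
    to 0 first and then to \<open>s\<close>, so exactly one product of indicators is 1 at each
    point.\<close>
  also have "\<dots> = (\<integral>\<^sup>+s. \<integral>\<^sup>+t. (?f s t * indicator {..0} s * indicator {..0} t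
      + ?f s t * indicator {0<..} s * indicator {..0} (t - s))
      + ?f s t * indicator {0<..} t * indicator {..<0} (s - t) \<partial>lborel \<partial>lborel)"
    by (intro nn_integral_cong) (auto simp: indicator_def)
  also have "\<dots> = (\<integral>\<^sup>+s. \<integral>\<^sup>+t. ?f s t * indicator {..0} s * indicator {..0} t \<partial>lborel \<partial>lborel)
      + (\<integral>\<^sup>+s. \<integral>\<^sup>+t. ?f s t * indicator {0<..} s * indicator {..0} (t - s) \<partial>lborel \<partial>lborel)
      + (\<integral>\<^sup>+s. \<integral>\<^sup>+t. ?f s t * indicator {0<..} t * indicator {..<0} (s - t) \<partial>lborel \<partial>lborel)"
    by (simp add: nn_integral_add)
  \<comment> \<open>Exchanging the order of integration and using the symmetry in \<open>s\<close>
    and \<open>t\<close> brings the third sector to the form of the second, with an open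
    half-line.\<close>
  also have "(\<integral>\<^sup>+s. \<integral>\<^sup>+t. ?f s t * indicator {0<..} t * indicator {..<0} (s - t) \<partial>lborel \<partial>lborel)
      = (\<integral>\<^sup>+t. \<integral>\<^sup>+s. ?f t s * indicator {0<..} t * indicator {..<0} (s - t) \<partial>lborel \<partial>lborel)"
    by (subst lborel_pair.Fubini') (auto simp: truncated_area_commute)
  also have "\<dots> = sector_integral L"
    by (rule sector_integral_shear) simp
  also have "(\<integral>\<^sup>+s. \<integral>\<^sup>+t. ?f s t * indicator {0<..} s * indicator {..0} (t - s) \<partial>lborel \<partial>lborel) = sector_integral L"
    by (rule sector_integral_shear) simp
  also have "(\<integral>\<^sup>+s. \<integral>\<^sup>+t. ?f s t * indicator {..0} s * indicator {..0} t \<partial>lborel \<partial>lborel) = sector_integral L"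
    by (rule sector_integral_neg)
  also have "sector_integral L + sector_integral L + sector_integral L = 3 * sector_integral L"
    by (metis distrib_right mult_1 one_add_one numeral_plus_one semiring_norm(5) add.commute)
  finally show ?thesis .
qed

section \<open>From the sector bounds to the asymptotic expansion\<close>

lemma lint_truncated_area_bounds:
  assumes "0 \<le> L"
  shows "\<bar>(LINT p|lborel. truncated_area L (fst p) (snd p)) - 3 * (L\<^sup>2 / 2 + L + 1)\<bar> \<le> 54"
proof -
  define J where "J = enn2real (sector_integral L)"
  \<comment> \<open>Finiteness matters here: \<open>enn2real\<close> sends \<open>top\<close> to
    0.\<close>
  have fin: "sector_integral L < top"
    using sector_integral_le[OF assms] by (rule order.strict_trans1) simp
  then have J: "sector_integral L = ennreal J" "0 \<le> J"
    by (auto simp: J_def)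
  have "J \<le> L\<^sup>2 / 2 + L + 1"
    using sector_integral_le[OF assms] assms unfolding J by (simp del: ennreal_plus)
  moreover have "L\<^sup>2 / 2 + L + 1 \<le> J + 18"
    using le_sector_integral[OF assms] J(2) unfolding J
    by (simp flip: ennreal_numeral ennreal_plus)
  moreover have "(LINT p|lborel. truncated_area L (fst p) (snd p)) = 3 * J"
  proof -
    have "(LINT p|lborel. truncated_area L (fst p) (snd p))
        = enn2real (\<integral>\<^sup>+p. ennreal (truncated_area L (fst p) (snd p)) \<partial>lborel)"
      by (rule integral_eq_nn_integral) (auto simp: truncated_area_def simp flip: lborel_prod)
    also have "\<dots> = 3 * J"
      by (simp add: nn_integral_truncated_area enn2real_mult J_def)
    finally show ?thesis .
  qed
  \<comment> \<open>Three sectors with error at most 18 each give 54.\<close>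
  ultimately show ?thesis by (simp add: abs_le_iff)
qed

text \<open>The prefactor is \<open>d * 4 * pi^2 / (4 * pi) = pi * d\<close>, which explains the
  choice \<open>L = ln (pi * d)\<close>.\<close>

lemma truncated_area_eq:
  assumes "0 < d"
  shows "truncated_area (ln (pi * d)) (fst t) (snd t) = min 1 (d * torus_area t / (4 * pi))"
  using assms
  by (simp add: truncated_area_def torus_area_def case_prod_beta exp_add power2_eq_square mult_ac)

theorem theorem3p9:
  "(\<lambda>d::nat. (LINT t|lborel. min 1 (real d * torus_area t / (4 * pi)))
      - (3 / 2 * (ln (real d))\<^sup>2 + 3 * (1 + ln pi) * ln (real d)))
   \<in> O(\<lambda>_. 1)"
proof (rule bigoI)
  \<comment> \<open>The terms free of \<open>ln d\<close> in \<open>3 * (L^2 / 2 + L + 1)\<close>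
    after substituting \<open>L = ln pi + ln d\<close>.\<close>
  define c where "c = 3 / 2 * (ln pi)\<^sup>2 + 3 * ln pi + 3"
  have bound: "norm ((LINT t|lborel. min 1 (real d * torus_area t / (4 * pi)))
      - (3 / 2 * (ln (real d))\<^sup>2 + 3 * (1 + ln pi) * ln (real d))) \<le> (54 + \<bar>c\<bar>) * norm (1::real)"
    if "1 \<le> d" for d :: nat
  proof -
    define L where "L = ln (pi * real d)"
    have "1 * 1 \<le> pi * real d"
      using that pi_ge_two by (intro mult_mono) auto
    then have "0 \<le> L" by (simp add: L_def)
    have "L = ln pi + ln (real d)" using that by (simp add: L_def ln_mult)
    then have "3 * (L\<^sup>2 / 2 + L + 1) = 3 / 2 * (ln (real d))\<^sup>2 + 3 * (1 + ln pi) * ln (real d) + c"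
      by (simp add: c_def power2_eq_square algebra_simps)
    moreover have "\<bar>(LINT t|lborel. min 1 (real d * torus_area t / (4 * pi))) - 3 * (L\<^sup>2 / 2 + L + 1)\<bar> \<le> 54"
      using lint_truncated_area_bounds[OF \<open>0 \<le> L\<close>] that by (simp add: L_def truncated_area_eq)
    ultimately show ?thesis by simp
  qed
  show "\<forall>\<^sub>F d in sequentially. norm ((LINT t|lborel. min 1 (real d * torus_area t / (4 * pi)))
      - (3 / 2 * (ln (real d))\<^sup>2 + 3 * (1 + ln pi) * ln (real d))) \<le> (54 + \<bar>c\<bar>) * norm (1::real)"
    using eventually_ge_at_top[of 1] by eventually_elim (rule bound)
qed

end
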